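(* For $n\ge3$, let $D_n=\langle R,S\rangle$ be the irreducible real reflection group (dihedral group) generated by $$R=\begin{pmatrix}\cos\frac{2\pi}{n}&-\sin\frac{2\pi}{n}\\ \sin\frac{2\pi}{n}&\cos\frac{2\pi}{n}\end{pmatrix},\qquad S=\begin{pmatrix}1&0\\0&-1\end{pmatrix}.$$ The systems of imprimitivity of the groups $D_n$, $n\ge 3$, viewed as groups of matrices over $\mathbb{H}$, are those given by $(1,q)$, $q\in\mathbb{H}$, in exactly the following cases: (a) $(1,0)$ and $(1,1)$, for $D_4$; (b) $(1,i)$, for $D_n$, $n\ge3$; (c) $(1,q)$ with $|q|=1$, $q\in\mathbb{H}\setminus\mathbb{C}$, $\mathrm{Re}(q)=0$, for $D_n$, $n\ge3$. Here, for $|q|=1$, the vectors $(1,q)$ and $(1,-q)$ give the same system, so that a system may be listed twice; apart from this, different $q$ in the list give different systems.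
   Context: $\mathbb{H}$ denotes the quaternions with standard units $i,j,k$, and $\mathbb{C}=\mathbb{R}+\mathbb{R}i\subset\mathbb{H}$. $\mathbb{H}^2$ is a right vector space (matrices act on the left), with inner product $\langle v,w\rangle=\sum_j\overline{v_j}w_j$. A system of imprimitivity of a group $G\subset\mathrm{GL}(\mathbb{H}^2)$ is an unordered pair $\{V_1,V_2\}$ of one-dimensional subspaces with $\mathbb{H}^2=V_1\oplus V_2$ which is permuted by every element of $G$. The system given by $(1,q)$ is the pair consisting of the span of $(1,q)$ and its orthogonal complement, the span of $(-\overline{q},1)$. *)

theory Defs
  imports "HOL-Analysis.Analysis" "HOL-Algebra.Generated_Groups"
begin

datatype quat = Quat (qRe: real) (qIm1: real) (qIm2: real) (qIm3: real)

lemma quat_eq_iff: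
  "x = y \<longleftrightarrow> qRe x = qRe y \<and> qIm1 x = qIm1 y \<and> qIm2 x = qIm2 y \<and> qIm3 x = qIm3 y"
  by (auto intro: quat.expand)

instantiation quat :: ab_group_add
begin

definition "0 = Quat 0 0 0 0"
definition "x + y = Quat (qRe x + qRe y) (qIm1 x + qIm1 y) (qIm2 x + qIm2 y) (qIm3 x + qIm3 y)"
definition "- x = Quat (- qRe x) (- qIm1 x) (- qIm2 x) (- qIm3 x)"
definition "x - y = Quat (qRe x - qRe y) (qIm1 x - qIm1 y) (qIm2 x - qIm2 y) (qIm3 x - qIm3 y)"

instance
  by standard
    (simp_all add: quat_eq_iff zero_quat_def plus_quat_def uminus_quat_def minus_quat_def)

end

definition quat_cnj :: "quat \<Rightarrow> quat" where
  "quat_cnj x = Quat (qRe x) (- qIm1 x) (- qIm2 x) (- qIm3 x)"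

instantiation quat :: real_div_algebra
begin

definition "1 = Quat 1 0 0 0"

definition "x * y = Quat
  (qRe x * qRe y - qIm1 x * qIm1 y - qIm2 x * qIm2 y - qIm3 x * qIm3 y)
  (qRe x * qIm1 y + qIm1 x * qRe y + qIm2 x * qIm3 y - qIm3 x * qIm2 y)
  (qRe x * qIm2 y - qIm1 x * qIm3 y + qIm2 x * qRe y + qIm3 x * qIm1 y)
  (qRe x * qIm3 y + qIm1 x * qIm2 y - qIm2 x * qIm1 y + qIm3 x * qRe y)"

definition "r *\<^sub>R x = Quat (r * qRe x) (r * qIm1 x) (r * qIm2 x) (r * qIm3 x)"

definition "inverse x =
  inverse ((qRe x)\<^sup>2 + (qIm1 x)\<^sup>2 + (qIm2 x)\<^sup>2 + (qIm3 x)\<^sup>2) *\<^sub>R quat_cnj x"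

definition "(x :: quat) div y = x * inverse y"

lemma quat_sel_simps [simp]:
  "qRe 0 = 0" "qIm1 0 = 0" "qIm2 0 = 0" "qIm3 0 = 0"
  "qRe 1 = 1" "qIm1 1 = 0" "qIm2 1 = 0" "qIm3 1 = 0"
  "qRe (x + y) = qRe x + qRe y" "qIm1 (x + y) = qIm1 x + qIm1 y"
  "qIm2 (x + y) = qIm2 x + qIm2 y" "qIm3 (x + y) = qIm3 x + qIm3 y"
  "qRe (x - y) = qRe x - qRe y" "qIm1 (x - y) = qIm1 x - qIm1 y"
  "qIm2 (x - y) = qIm2 x - qIm2 y" "qIm3 (x - y) = qIm3 x - qIm3 y"
  "qRe (- x) = - qRe x" "qIm1 (- x) = - qIm1 x"
  "qIm2 (- x) = - qIm2 x" "qIm3 (- x) = - qIm3 x"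
  "qRe (r *\<^sub>R x) = r * qRe x" "qIm1 (r *\<^sub>R x) = r * qIm1 x"
  "qIm2 (r *\<^sub>R x) = r * qIm2 x" "qIm3 (r *\<^sub>R x) = r * qIm3 x"
  "qRe (quat_cnj x) = qRe x" "qIm1 (quat_cnj x) = - qIm1 x"
  "qIm2 (quat_cnj x) = - qIm2 x" "qIm3 (quat_cnj x) = - qIm3 x"
  "qRe (x * y) = qRe x * qRe y - qIm1 x * qIm1 y - qIm2 x * qIm2 y - qIm3 x * qIm3 y"
  "qIm1 (x * y) = qRe x * qIm1 y + qIm1 x * qRe y + qIm2 x * qIm3 y - qIm3 x * qIm2 y"
  "qIm2 (x * y) = qRe x * qIm2 y - qIm1 x * qIm3 y + qIm2 x * qRe y + qIm3 x * qIm1 y"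
  "qIm3 (x * y) = qRe x * qIm3 y + qIm1 x * qIm2 y - qIm2 x * qIm1 y + qIm3 x * qRe y"
  by (simp_all add: zero_quat_def one_quat_def plus_quat_def minus_quat_def uminus_quat_def
      scaleR_quat_def quat_cnj_def times_quat_def)

lemma quat_sumsq_eq_0_iff:
  "(qRe x)\<^sup>2 + (qIm1 x)\<^sup>2 + (qIm2 x)\<^sup>2 + (qIm3 x)\<^sup>2 = 0 \<longleftrightarrow> x = 0"
  by (auto simp: quat_eq_iff add_nonneg_eq_0_iff)

instance
proof
  fix x y z :: quat and a b :: real
  show "x * y * z = x * (y * z)"
    by (simp add: quat_eq_iff algebra_simps)
  show "(x + y) * z = x * z + y * z" "x * (y + z) = x * y + x * z"
    by (simp_all add: quat_eq_iff algebra_simps)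
  show "1 * x = x" "x * 1 = x" "(0 :: quat) \<noteq> 1"
    by (simp_all add: quat_eq_iff)
  show "a *\<^sub>R (x + y) = a *\<^sub>R x + a *\<^sub>R y" "(a + b) *\<^sub>R x = a *\<^sub>R x + b *\<^sub>R x"
    "a *\<^sub>R b *\<^sub>R x = (a * b) *\<^sub>R x" "1 *\<^sub>R x = x"
    "(a *\<^sub>R x) * y = a *\<^sub>R (x * y)" "x * (a *\<^sub>R y) = a *\<^sub>R (x * y)"
    by (simp_all add: quat_eq_iff algebra_simps)
  let ?s = "(qRe x)\<^sup>2 + (qIm1 x)\<^sup>2 + (qIm2 x)\<^sup>2 + (qIm3 x)\<^sup>2"
  have cnj: "quat_cnj x * x = ?s *\<^sub>R 1" "x * quat_cnj x = ?s *\<^sub>R 1"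
    by (simp_all add: quat_eq_iff power2_eq_square algebra_simps)
  have scale: "(a *\<^sub>R u) * v = a *\<^sub>R (u * v)" "u * (a *\<^sub>R v) = a *\<^sub>R (u * v)"
    "a *\<^sub>R b *\<^sub>R u = (a * b) *\<^sub>R u" "1 *\<^sub>R u = u" for a b :: real and u v :: quat
    by (simp_all add: quat_eq_iff algebra_simps)
  show "inverse x * x = 1" "x * inverse x = 1" if "x \<noteq> 0"
    using that quat_sumsq_eq_0_iff[of x] by (simp_all add: inverse_quat_def scale cnj)
  show "inverse (0 :: quat) = 0"
    by (simp add: inverse_quat_def quat_eq_iff)
  show "x div y = x * inverse y"
    by (simp add: divide_quat_def)
qed

end

instantiation quat :: real_inner
begin

definition "inner x y = qRe x * qRe y + qIm1 x * qIm1 y + qIm2 x * qIm2 y + qIm3 x * qIm3 y"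

definition "norm x = sqrt ((qRe x)\<^sup>2 + (qIm1 x)\<^sup>2 + (qIm2 x)\<^sup>2 + (qIm3 x)\<^sup>2)"

definition "sgn x = x /\<^sub>R norm (x :: quat)"

definition "dist x y = norm (x - y :: quat)"

definition
  "(uniformity :: (quat \<times> quat) filter) = (INF e\<in>{0 <..}. principal {(x, y). dist x y < e})"

definition
  "open (U :: quat set) \<longleftrightarrow> (\<forall>x\<in>U. eventually (\<lambda>(x', y). x' = x \<longrightarrow> y \<in> U) uniformity)"

instance
proof
  fix x y z :: quat and r :: real
  show "inner x y = inner y x" "inner (x + y) z = inner x z + inner y z"
    "inner (r *\<^sub>R x) y = r * inner x y" "0 \<le> inner x x"
    by (simp_all add: inner_quat_def algebra_simps)
  show "inner x x = 0 \<longleftrightarrow> x = 0"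
    using quat_sumsq_eq_0_iff[of x] by (simp add: inner_quat_def power2_eq_square)
  show "norm x = sqrt (inner x x)"
    by (simp add: inner_quat_def norm_quat_def power2_eq_square)
qed (rule sgn_quat_def dist_quat_def uniformity_quat_def open_quat_def)+

end

instance quat :: real_normed_div_algebra
proof
  fix x y :: quat
  show "norm (x * y) = norm x * norm y"
    by (simp add: norm_quat_def real_sqrt_mult [symmetric] power2_eq_square algebra_simps)
qed

definition quat_i :: quat where "quat_i = Quat 0 1 0 0"
definition quat_j :: quat where "quat_j = Quat 0 0 1 0"
definition quat_k :: quat where "quat_k = Quat 0 0 0 1"

lemma quat_units:
  "quat_i * quat_i = -1" "quat_j * quat_j = -1" "quat_k * quat_k = -1"
  "quat_i * quat_j = quat_k" "quat_j * quat_k = quat_i" "quat_k * quat_i = quat_j"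
  "Quat a b c d = of_real a + of_real b * quat_i + of_real c * quat_j + of_real d * quat_k"
  by (simp_all add: quat_eq_iff quat_i_def quat_j_def quat_k_def of_real_def)

definition quat_complex :: "quat set" where
  "quat_complex = {of_real x + of_real y * quat_i | x y. True}"

(* Scalars act on the right, so that the left action of matrices is linear. *)
definition right_scale :: "quat^'n \<Rightarrow> quat \<Rightarrow> quat^'n" where
  "right_scale v a = (\<chi> i. v $ i * a)"

definition right_subspace :: "(quat^'n) set \<Rightarrow> bool" where
  "right_subspace V \<longleftrightarrow>
     0 \<in> V \<and> (\<forall>v\<in>V. \<forall>w\<in>V. v + w \<in> V) \<and> (\<forall>v\<in>V. \<forall>a. right_scale v a \<in> V)"

definition right_span :: "(quat^'n) set \<Rightarrow> (quat^'n) set" where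
  "right_span S = right_subspace hull S"

definition right_line :: "(quat^'n) set \<Rightarrow> bool" where
  "right_line V \<longleftrightarrow> (\<exists>v. v \<noteq> 0 \<and> V = right_span {v})"

definition direct_sum_decomp :: "(quat^'n) set \<Rightarrow> (quat^'n) set \<Rightarrow> bool" where
  "direct_sum_decomp V W \<longleftrightarrow> (\<forall>x. \<exists>v\<in>V. \<exists>w\<in>W. x = v + w) \<and> V \<inter> W = {0}"

definition quat_inner :: "quat^'n \<Rightarrow> quat^'n \<Rightarrow> quat" where
  "quat_inner v w = (\<Sum>j\<in>UNIV. quat_cnj (v $ j) * w $ j)"

definition quat_orthogonal_complement :: "(quat^'n) set \<Rightarrow> (quat^'n) set" where
  "quat_orthogonal_complement V = {w. \<forall>v\<in>V. quat_inner v w = 0}"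

lemma right_span_singleton: "right_span {v} = range (right_scale v)"
  unfolding right_span_def
proof (rule hull_unique)
  show "{v} \<subseteq> range (right_scale v)"
    by (auto simp: right_scale_def vec_eq_iff intro!: range_eqI[where x = 1])
  have "right_scale v 0 = 0" "right_scale v a + right_scale v b = right_scale v (a + b)"
    "right_scale (right_scale v a) b = right_scale v (a * b)" for a b
    by (simp_all add: right_scale_def vec_eq_iff distrib_left mult.assoc)
  then show "right_subspace (range (right_scale v))"
    unfolding right_subspace_def image_iff Ball_def Bex_def by simp metis
qed (auto simp: right_subspace_def)

(* The unordered pair is the set {V, W}, and g permutes it by acting on subspaces by image. *)
definition system_of_imprimitivity :: "(quat^2^2) set \<Rightarrow> (quat^2) set set \<Rightarrow> bool" where
  "system_of_imprimitivity G P \<longleftrightarrow>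
     (\<exists>V W. P = {V, W} \<and> right_line V \<and> right_line W \<and> direct_sum_decomp V W) \<and>
     (\<forall>g\<in>G. (\<lambda>U. (*v) g ` U) ` P = P)"

definition system_given_by :: "quat \<Rightarrow> (quat^2) set set" where
  "system_given_by q =
     {right_span {vector [1, q]}, quat_orthogonal_complement (right_span {vector [1, q]})}"

lemma orthogonal_complement_span:
  "quat_orthogonal_complement (right_span {vector [1, q]}) =
   right_span {vector [- quat_cnj q, 1] :: quat^2}"
proof -
  have cnj_mult: "quat_cnj (a * b) = quat_cnj b * quat_cnj a" for a b
    by (simp add: quat_eq_iff)
  have cnj_one: "quat_cnj 1 = 1"
    by (simp add: quat_eq_iff)
  have inner: "quat_inner (right_scale (vector [1, q]) a) w = quat_cnj a * (w $ 1 + quat_cnj q * w $ 2)"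
    for a and w :: "quat^2"
    by (simp add: quat_inner_def sum_2 right_scale_def cnj_mult distrib_left mult.assoc cnj_one)
  from cnj_one have "(\<forall>a. quat_cnj a * u = 0) \<longleftrightarrow> u = 0" for u
    by (metis mult_1 mult_zero_right)
  then have "w \<in> quat_orthogonal_complement (right_span {vector [1, q]}) \<longleftrightarrow>
      w $ 1 + quat_cnj q * w $ 2 = 0" for w :: "quat^2"
    unfolding quat_orthogonal_complement_def right_span_singleton by (simp add: inner)
  moreover have "w \<in> right_span {vector [- quat_cnj q, 1]} \<longleftrightarrow>
      w $ 1 + quat_cnj q * w $ 2 = 0" for w :: "quat^2"
    unfolding right_span_singleton image_iff
    by (simp add: right_scale_def vec_eq_iff forall_2) (metis eq_neg_iff_add_eq_0)
  ultimately show ?thesis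
    by blast
qed

definition GL :: "('a::semiring_1^'n^'n) monoid" where
  "GL = \<lparr>carrier = {A. invertible A}, monoid.mult = (**), one = mat 1\<rparr>"

lemma group_GL: "group (GL :: ('a::semiring_1^'n^'n) monoid)"
proof (rule groupI)
  fix A :: "'a^'n^'n"
  assume "A \<in> carrier GL"
  then show "\<exists>B\<in>carrier GL. B \<otimes>\<^bsub>GL\<^esub> A = \<one>\<^bsub>GL\<^esub>"
    by (auto simp: GL_def invertible_def)
next
  show "\<one>\<^bsub>GL\<^esub> \<in> carrier (GL :: ('a^'n^'n) monoid)"
    by (auto simp: GL_def invertible_def intro!: exI[where x = "mat 1"])
next
  fix A B :: "'a^'n^'n"
  assume "A \<in> carrier GL" "B \<in> carrier GL"
  then obtain A' B' where "A ** A' = mat 1" "A' ** A = mat 1" "B ** B' = mat 1" "B' ** B = mat 1"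
    by (auto simp: GL_def invertible_def)
  then have "(A ** B) ** (B' ** A') = mat 1" "(B' ** A') ** (A ** B) = mat 1"
    by (metis matrix_mul_assoc matrix_mul_rid)+
  then show "A \<otimes>\<^bsub>GL\<^esub> B \<in> carrier GL"
    by (auto simp: GL_def invertible_def)
qed (auto simp: GL_def matrix_mul_assoc)

definition dihedral_R :: "nat \<Rightarrow> real^2^2" where
  "dihedral_R n = vector
     [vector [cos (2 * pi / real n), - sin (2 * pi / real n)],
      vector [sin (2 * pi / real n), cos (2 * pi / real n)]]"

definition dihedral_S :: "real^2^2" where
  "dihedral_S = vector [vector [1, 0], vector [0, -1]]"

definition dihedral :: "nat \<Rightarrow> (real^2^2) set" where
  "dihedral n = generate GL {dihedral_R n, dihedral_S}"

lemma dihedral_generators: "{dihedral_R n, dihedral_S} \<subseteq> carrier GL"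
  by (auto simp: GL_def invertible_det_nz det_2 dihedral_R_def dihedral_S_def
      power2_eq_square [symmetric] eq_neg_iff_add_eq_0)

definition dihedral_quat :: "nat \<Rightarrow> (quat^2^2) set" where
  "dihedral_quat n = map_matrix of_real ` dihedral n"

(* The parameters q are listed as vectors (1, q), not as systems: in the last case both q and -q
   occur, although they give the same system, whereas -quat_i does not occur in the second. *)
definition listed :: "nat \<Rightarrow> quat \<Rightarrow> bool" where
  "listed n q \<longleftrightarrow>
     n = 4 \<and> (q = 0 \<or> q = 1) \<or>
     q = quat_i \<or>
     norm q = 1 \<and> q \<notin> quat_complex \<and> qRe q = 0"

end

theory Submission
  imports Defs
begin

text \<open>
  A line in the plane over the quaternions is determined by its slope: it is spanned by \<open>(1, q)\<close>
  for exactly one \<open>q\<close>, or it is the vertical line spanned by \<open>(0, 1)\<close>.  A system of imprimitivity of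
  \<open>D\<^sub>n\<close> is an unordered pair of complementary lines permuted by the two generators, since
  permuting a pair passes to products and inverses (\<open>dihedral_quat_permutes_lines_iff\<close>).

  The reflection \<open>S\<close> negates slopes and fixes the vertical line.  Two distinct lines that it permutes
  are therefore either both fixed, and then they are the coordinate axes, or interchanged, and then
  they have slopes \<open>q\<close> and \<open>- q\<close> with \<open>q \<noteq> 0\<close> (\<open>dihedral_S_permutes_cases\<close>).

  Let \<open>c\<close> and \<open>s\<close> be the cosine and sine of the angle \<open>2\<pi>/n\<close> of the rotation \<open>R\<close>; for \<open>n \<ge> 3\<close>
  one has \<open>s > 0\<close>, and \<open>c = 0\<close> only for \<open>n = 4\<close>.  The rotation sends \<open>(1, q)\<close> to
  \<open>(c - s q, s + c q)\<close>, so it permutes the axes only if \<open>c = 0\<close>.  It fixes the line of slope \<open>q\<close>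
  if and only if \<open>s (q\<^sup>2 + 1) = 0\<close>, that is, \<open>q\<^sup>2 = -1\<close>, which is the same as \<open>|q| = 1\<close> and
  \<open>Re q = 0\<close>.  It interchanges the slopes \<open>q\<close> and \<open>- q\<close> only if
  \<open>s (1 - q\<^sup>2) + 2 c q = 0\<close> and the same holds for \<open>- q\<close>; together these force \<open>c = 0\<close> and
  \<open>q\<^sup>2 = 1\<close> (\<open>dihedral_R_permutes_mirror_pair_iff\<close>).

  The axes form the system given by \<open>(1, 0)\<close>.  In all other surviving cases one has \<open>|q| = 1\<close>,
  and then the line of slope \<open>- q\<close> is the orthogonal complement of the line of slope \<open>q\<close>
  (\<open>system_given_by_unit\<close>).  So the pair is the system given by \<open>(1, q)\<close>, and also the one given by \<open>(1, - q)\<close>.  At least one of the two is listed: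
  among the complex \<open>q\<close> with \<open>q\<^sup>2 = -1\<close> there are only \<open>i\<close> and \<open>- i\<close>, and \<open>q\<^sup>2 = 1\<close> gives
  only \<open>1\<close> and \<open>-1\<close>.
\<close>

section \<open>Quaternions with square \<open>\<plusminus>1\<close>\<close>

text \<open>
  The imaginary part of \<open>q\<^sup>2\<close> is \<open>2 Re q\<close> times the imaginary part of \<open>q\<close>.  If the real part were
  nonzero, \<open>q\<close> would be real and its square could not be negative.
\<close>

lemma quat_square_eq_minus_1_iff: "q * q = -1 \<longleftrightarrow> norm q = 1 \<and> qRe q = 0"
proof
  assume "q * q = -1"
  then have eqs: "qRe q * qRe q - qIm1 q * qIm1 q - qIm2 q * qIm2 q - qIm3 q * qIm3 q = -1"
    "qRe q * qIm1 q = 0" "qRe q * qIm2 q = 0" "qRe q * qIm3 q = 0"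
    by (auto simp: quat_eq_iff)
  have "qRe q = 0"
  proof (rule ccontr)
    assume "qRe q \<noteq> 0"
    with eqs have "qRe q * qRe q = -1"
      by simp
    then show False
      using zero_le_square[of "qRe q"] by linarith
  qed
  with eqs show "norm q = 1 \<and> qRe q = 0"
    by (simp add: norm_quat_def power2_eq_square)
next
  assume "norm q = 1 \<and> qRe q = 0"
  then show "q * q = -1"
    by (auto simp: norm_quat_def quat_eq_iff power2_eq_square)
qed

lemma quat_complex_iff: "q \<in> quat_complex \<longleftrightarrow> qIm2 q = 0 \<and> qIm3 q = 0"
proof
  assume "q \<in> quat_complex"
  then show "qIm2 q = 0 \<and> qIm3 q = 0"
    by (auto simp: quat_complex_def quat_i_def of_real_def)
next
  assume "qIm2 q = 0 \<and> qIm3 q = 0"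
  then have "q = of_real (qRe q) + of_real (qIm1 q) * quat_i"
    by (simp add: quat_eq_iff quat_i_def of_real_def)
  then show "q \<in> quat_complex"
    unfolding quat_complex_def by blast
qed

lemma quat_i_square: "quat_i * quat_i = -1"
  by (rule quat_units)

text \<open>
  Over the quaternions \<open>-1\<close> has a two-sphere of square roots; only two of them are complex, and they
  give the same system.  This is why \<open>i\<close> alone stands for the complex case.
\<close>

lemma quat_complex_square_eq_minus_1:
  assumes "q * q = -1" "q \<in> quat_complex"
  shows "q = quat_i \<or> q = - quat_i"
proof -
  have "qRe q = 0" "qIm2 q = 0" "qIm3 q = 0"
    using assms by (auto simp: quat_square_eq_minus_1_iff quat_complex_iff)
  moreover from this assms(1) have "qIm1 q = 1 \<or> qIm1 q = -1"
    by (simp add: quat_eq_iff square_eq_1_iff)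
  ultimately show ?thesis
    by (auto simp: quat_i_def quat_eq_iff)
qed

lemma quat_uminus_eq_self_iff: "- q = q \<longleftrightarrow> q = (0 :: quat)"
  by (auto simp: quat_eq_iff)

lemma quat_cnj_mult_self: "quat_cnj q * q = (norm q)\<^sup>2 *\<^sub>R 1" "q * quat_cnj q = (norm q)\<^sup>2 *\<^sub>R 1"
  by (simp_all add: quat_eq_iff norm_quat_def power2_eq_square algebra_simps)

lemma norm_eq_1_if_square_unit:
  fixes q :: quat
  assumes "q * q = -1 \<or> q * q = 1"
  shows "norm q = 1"
proof -
  have "norm q * norm q = 1"
    using assms by (metis norm_mult norm_minus_cancel norm_one)
  then show ?thesis
    using norm_ge_zero[of q] by (auto simp: square_eq_1_iff)
qed

section \<open>Lines in the quaternionic plane\<close>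

lemma mem_right_span_slope:
  "w \<in> right_span {vector [1, q] :: quat^2} \<longleftrightarrow> w $ 2 = q * w $ 1"
  unfolding right_span_singleton image_iff
  by (auto simp: right_scale_def vec_eq_iff forall_2)

lemma mem_right_span_vertical:
  "w \<in> right_span {vector [0, 1] :: quat^2} \<longleftrightarrow> w $ 1 = 0"
  unfolding right_span_singleton image_iff
  by (auto simp: right_scale_def vec_eq_iff forall_2)

lemma right_span_eq:
  assumes "v \<in> right_span {w}" "v \<noteq> 0"
  shows "right_span {v} = right_span {w}"
proof -
  obtain a where a: "v = right_scale w a"
    using assms(1) by (auto simp: right_span_singleton)
  with assms(2) have "a \<noteq> 0"
    by (auto simp: right_scale_def vec_eq_iff)
  have scale: "right_scale (right_scale w a) b = right_scale w (a * b)" for b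
    by (simp add: right_scale_def vec_eq_iff mult.assoc)
  have "right_scale w b = right_scale v (inverse a * b)" for b
    using \<open>a \<noteq> 0\<close> by (simp add: a scale mult.assoc[symmetric])
  then show ?thesis
    unfolding right_span_singleton a by (auto simp: scale)
qed

lemma mem_right_span_self: "v \<in> right_span {v}"
  unfolding right_span_def by (simp add: hull_inc)

text \<open>
  The next two lemmas turn equality of lines into equations between coordinates.  The nonvanishing
  conditions on the right exclude the span of the zero vector.
\<close>

lemma right_span_eq_slope_iff:
  "right_span {vector [a, b]} = right_span {vector [1, q] :: quat^2} \<longleftrightarrow> a \<noteq> 0 \<and> b = q * a"
proof
  assume eq: "right_span {vector [a, b]} = right_span {vector [1, q] :: quat^2}"
  then have "vector [a, b] \<in> right_span {vector [1, q] :: quat^2}"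
    using mem_right_span_self by blast
  then have b: "b = q * a"
    by (simp add: mem_right_span_slope)
  have "vector [1, q] \<in> right_span {vector [a, b] :: quat^2}"
    using eq mem_right_span_self by blast
  then have "a \<noteq> 0"
    by (auto simp: right_span_singleton right_scale_def vec_eq_iff forall_2)
  with b show "a \<noteq> 0 \<and> b = q * a" by simp
next
  assume "a \<noteq> 0 \<and> b = q * a"
  then show "right_span {vector [a, b]} = right_span {vector [1, q] :: quat^2}"
    by (intro right_span_eq) (auto simp: mem_right_span_slope vec_eq_iff forall_2)
qed

lemma right_span_eq_vertical_iff:
  "right_span {vector [a, b]} = right_span {vector [0, 1] :: quat^2} \<longleftrightarrow> a = 0 \<and> b \<noteq> 0"
proof
  assume eq: "right_span {vector [a, b]} = right_span {vector [0, 1] :: quat^2}"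
  then have "vector [a, b] \<in> right_span {vector [0, 1] :: quat^2}"
    using mem_right_span_self by blast
  then have a: "a = 0"
    by (simp add: mem_right_span_vertical)
  have "vector [0, 1] \<in> right_span {vector [a, b] :: quat^2}"
    using eq mem_right_span_self by blast
  then have "b \<noteq> 0"
    by (auto simp: right_span_singleton right_scale_def vec_eq_iff forall_2)
  with a show "a = 0 \<and> b \<noteq> 0" by simp
next
  assume "a = 0 \<and> b \<noteq> 0"
  then show "right_span {vector [a, b]} = right_span {vector [0, 1] :: quat^2}"
    by (intro right_span_eq) (auto simp: mem_right_span_vertical vec_eq_iff forall_2)
qed

lemma vertical_neq_slope:
  "right_span {vector [0, 1] :: quat^2} \<noteq> right_span {vector [1, q]}"
  "right_span {vector [1, q]} \<noteq> right_span {vector [0, 1] :: quat^2}"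
  by (simp_all add: right_span_eq_slope_iff right_span_eq_vertical_iff)

lemma right_line_cases:
  fixes V :: "(quat^2) set"
  assumes "right_line V"
  obtains (slope) q where "V = right_span {vector [1, q]}"
    | (vertical) "V = right_span {vector [0, 1]}"
proof -
  obtain v where v: "v \<noteq> 0" "V = right_span {v}"
    using assms by (auto simp: right_line_def)
  have v_eq: "v = vector [v $ 1, v $ 2]"
    by (simp add: vec_eq_iff forall_2)
  show thesis
  proof (cases "v $ 1 = 0")
    case True
    with v(1) have "v $ 2 \<noteq> 0"
      by (auto simp: vec_eq_iff forall_2)
    with True v_eq v(2) show thesis
      by (metis right_span_eq_vertical_iff vertical)
  next
    case False
    then have "v $ 2 = (v $ 2 * inverse (v $ 1)) * v $ 1"
      by (simp add: mult.assoc)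
    with False v_eq v(2) show thesis
      by (metis right_span_eq_slope_iff slope)
  qed
qed

lemma right_line_vector:
  "a \<noteq> 0 \<or> b \<noteq> 0 \<Longrightarrow> right_line (right_span {vector [a, b] :: quat^2})"
  unfolding right_line_def by (intro exI[of _ "vector [a, b]"]) (auto simp: vec_eq_iff forall_2)

lemma direct_sum_lines_neq:
  assumes "right_line V" "direct_sum_decomp V W"
  shows "V \<noteq> W"
proof
  assume "V = W"
  then have "V = {0}"
    using assms(2) by (simp add: direct_sum_decomp_def)
  with assms(1) show False
    using mem_right_span_self by (auto simp: right_line_def)
qed

section \<open>Systems given by a vector\<close>

lemma system_given_by_eq:
  "system_given_by q = {right_span {vector [1, q]}, right_span {vector [- quat_cnj q, 1]}}"
  by (simp add: system_given_by_def orthogonal_complement_span)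

lemma system_given_by_0:
  "system_given_by 0 = {right_span {vector [1, 0]}, right_span {vector [0, 1]}}"
proof -
  have "- quat_cnj 0 = 0" by (simp add: quat_eq_iff)
  then show ?thesis by (simp add: system_given_by_eq)
qed

lemma orthogonal_slope_eq_iff:
  "right_span {vector [- quat_cnj q, 1]} = right_span {vector [1, r] :: quat^2} \<longleftrightarrow> r * quat_cnj q = -1"
  by (auto simp: right_span_eq_slope_iff eq_neg_iff_add_eq_0 add.commute)

text \<open>
  The orthogonal complement is spanned by \<open>(- quat_cnj q, 1)\<close>, whose slope is the inverse of
  \<open>- quat_cnj q\<close>; for a unit quaternion this is \<open>- q\<close>.
\<close>

lemma system_given_by_unit:
  assumes "norm q = 1"
  shows "system_given_by q = {right_span {vector [1, q]}, right_span {vector [1, - q]}}"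
proof -
  have "- q * quat_cnj q = -1"
    using assms by (simp add: quat_cnj_mult_self)
  then show ?thesis
    by (metis system_given_by_eq orthogonal_slope_eq_iff)
qed

lemma system_given_by_uminus:
  assumes "norm q = 1"
  shows "system_given_by q = system_given_by (- q)"
  using assms by (simp add: system_given_by_unit insert_commute)

text \<open>
  The line of slope \<open>r\<close> belongs to the system given by \<open>(1, q)\<close>.  For \<open>q = 0\<close> the other line of this
  system is vertical, so \<open>r = 0\<close>; for a unit \<open>q\<close> the two lines have slopes \<open>q\<close> and \<open>- q\<close>.
\<close>

lemma system_given_by_inject:
  assumes "system_given_by q = system_given_by r" "q = 0 \<or> norm q = 1"
  shows "q = r \<or> norm q = 1 \<and> r = - q"
  using assms(2)
proof
  assume "q = 0"
  with assms(1) have "{right_span {vector [1, r]}, right_span {vector [- quat_cnj r, 1]}} =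
      {right_span {vector [1, 0]}, right_span {vector [0, 1] :: quat^2}}"
    using system_given_by_0 system_given_by_eq by simp
  then have "right_span {vector [1, r]} = right_span {vector [1, 0] :: quat^2}"
    by (auto simp: doubleton_eq_iff vertical_neq_slope)
  with \<open>q = 0\<close> show ?thesis
    by (simp add: right_span_eq_slope_iff)
next
  assume "norm q = 1"
  with assms(1) have "right_span {vector [1, r]} \<in>
      {right_span {vector [1, q]}, right_span {vector [1, - q] :: quat^2}}"
    using system_given_by_unit system_given_by_eq by blast
  with \<open>norm q = 1\<close> show ?thesis
    by (auto simp: right_span_eq_slope_iff)
qed

text \<open>
  The coordinates of a vector with respect to \<open>(1, q)\<close> and \<open>(- quat_cnj q, 1)\<close> come from orthogonal
  projection: both basis vectors have squared length \<open>1 + |q|\<^sup>2\<close>.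
\<close>

lemma direct_sum_orthogonal:
  "direct_sum_decomp (right_span {vector [1, q]}) (right_span {vector [- quat_cnj q, 1] :: quat^2})"
proof -
  let ?V = "right_span {vector [1, q] :: quat^2}"
  let ?W = "right_span {vector [- quat_cnj q, 1] :: quat^2}"
  define d where "d = 1 + (norm q)\<^sup>2"
  have d: "d > 0" by (simp add: d_def add_pos_nonneg)
  have d1: "quat_cnj q * (q * x) = (d - 1) *\<^sub>R x" "q * (quat_cnj q * x) = (d - 1) *\<^sub>R x" for x
    by (simp_all add: mult.assoc[symmetric] quat_cnj_mult_self d_def)
  have W: "w \<in> ?W \<longleftrightarrow> w $ 1 = - quat_cnj q * w $ 2" for w
    unfolding right_span_singleton image_iff
    by (auto simp: right_scale_def vec_eq_iff forall_2)
  have sum: "\<exists>v\<in>?V. \<exists>w\<in>?W. x = v + w" for x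
  proof -
    define a where "a = (1 / d) *\<^sub>R (x $ 1 + quat_cnj q * x $ 2)"
    define b where "b = (1 / d) *\<^sub>R (x $ 2 - q * x $ 1)"
    have a: "a - quat_cnj q * b = x $ 1"
    proof -
      have "a - quat_cnj q * b = (1 / d) *\<^sub>R (d *\<^sub>R x $ 1)"
        by (simp only: a_def b_def mult_scaleR_right scaleR_diff_right[symmetric])
          (simp add: right_diff_distrib d1 algebra_simps)
      with d show ?thesis by simp
    qed
    have b: "q * a + b = x $ 2"
    proof -
      have "q * a + b = (1 / d) *\<^sub>R (d *\<^sub>R x $ 2)"
        by (simp only: a_def b_def mult_scaleR_right scaleR_add_right[symmetric])
          (simp add: distrib_left d1 algebra_simps)
      with d show ?thesis by simp
    qed
    have "vector [a, q * a] \<in> ?V" "vector [- quat_cnj q * b, b] \<in> ?W"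
      by (simp_all add: mem_right_span_slope W)
    moreover have "x = vector [a, q * a] + vector [- quat_cnj q * b, b]"
      using a b by (simp add: vec_eq_iff forall_2)
    ultimately show ?thesis by blast
  qed
  have int: "w = 0" if "w \<in> ?V" "w \<in> ?W" for w
  proof -
    have w2: "w $ 2 = q * w $ 1" and w1: "w $ 1 = - quat_cnj q * w $ 2"
      using that by (simp_all add: mem_right_span_slope W)
    have "w $ 1 + (d - 1) *\<^sub>R w $ 1 = 0"
      using w1 by (metis w2 d1(1) mult_minus_left add.right_inverse add.commute)
    then have "d *\<^sub>R w $ 1 = 0"
      by (simp add: scaleR_diff_left)
    with d w2 show ?thesis by (simp add: vec_eq_iff forall_2)
  qed
  have "0 \<in> ?V" "0 \<in> ?W"
    by (simp_all add: mem_right_span_slope W)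
  with sum int show ?thesis
    unfolding direct_sum_decomp_def by blast
qed

section \<open>Matrices permuting a pair of lines\<close>

abbreviation permutes_lines :: "quat^'n^'n \<Rightarrow> (quat^'n) set set \<Rightarrow> bool" where
  "permutes_lines g P \<equiv> (\<lambda>U. (*v) g ` U) ` P = P"

lemma permutes_lines_mult:
  assumes "permutes_lines g P" "permutes_lines h P"
  shows "permutes_lines (g ** h) P"
proof -
  have "(\<lambda>U. (*v) (g ** h) ` U) ` P = (\<lambda>U. (*v) g ` U) ` (\<lambda>U. (*v) h ` U) ` P"
    by (simp add: image_image matrix_vector_mul_assoc)
  with assms show ?thesis by simp
qed

lemma permutes_lines_left_inverse:
  assumes "permutes_lines g P" "h ** g = mat 1"
  shows "permutes_lines h P"
proof -
  have "(\<lambda>U. (*v) h ` U) ` P = (\<lambda>U. (*v) h ` U) ` (\<lambda>U. (*v) g ` U) ` P"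
    using assms(1) by simp
  also have "\<dots> = P"
    by (simp add: image_image matrix_vector_mul_assoc assms(2))
  finally show ?thesis .
qed

lemma map_matrix_of_real_mult:
  "map_matrix of_real (A ** B) = map_matrix of_real A ** (map_matrix of_real B :: quat^'n^'n)"
  by (simp add: map_matrix_def matrix_matrix_mult_def vec_eq_iff)

lemma map_matrix_of_real_mat_1: "map_matrix of_real (mat 1) = (mat 1 :: quat^'n^'n)"
  by (simp add: map_matrix_def mat_def vec_eq_iff)

text \<open>
  The elements that permute a given pair form a subgroup, so it is enough to test generators.  This
  uses that the embedding of real matrices into quaternionic ones is multiplicative.
\<close>

lemma dihedral_quat_permutes_lines_iff:
  "(\<forall>g\<in>dihedral_quat n. permutes_lines g P) \<longleftrightarrow>
     permutes_lines (map_matrix of_real (dihedral_R n)) P \<and>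
     permutes_lines (map_matrix of_real dihedral_S) P"
  (is "?L \<longleftrightarrow> ?R")
proof
  assume ?L
  moreover have "dihedral_R n \<in> dihedral n" "dihedral_S \<in> dihedral n"
    by (auto simp: dihedral_def intro: generate.incl)
  ultimately show ?R
    by (simp add: dihedral_quat_def)
next
  assume R: ?R
  interpret group "GL :: (real^2^2) monoid"
    by (rule group_GL)
  have "permutes_lines (map_matrix of_real A) P" if "A \<in> dihedral n" for A
    using that unfolding dihedral_def
  proof (induction rule: generate.induct)
    case one
    show ?case by (simp add: GL_def map_matrix_of_real_mat_1)
  next
    case (incl h)
    with R show ?case by auto
  next
    case (inv h)
    with dihedral_generators have "inv\<^bsub>GL\<^esub> h ** h = mat 1"
      using l_inv[of h] by (auto simp: GL_def)
    then have "map_matrix of_real (inv\<^bsub>GL\<^esub> h) ** map_matrix of_real h = (mat 1 :: quat^2^2)"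
      by (simp add: map_matrix_of_real_mult[symmetric] map_matrix_of_real_mat_1)
    moreover have "permutes_lines (map_matrix of_real h) P"
      using inv R by auto
    ultimately show ?case
      by (rule permutes_lines_left_inverse[rotated])
  next
    case (eng h1 h2)
    then show ?case
      by (simp add: GL_def map_matrix_of_real_mult permutes_lines_mult)
  qed
  then show ?L
    by (simp add: dihedral_quat_def)
qed

lemma matrix_image_right_span: "(*v) g ` right_span {v} = right_span {g *v v}"
proof -
  have "g *v right_scale v a = right_scale (g *v v) a" for a
    by (simp add: right_scale_def matrix_vector_mult_def vec_eq_iff sum_distrib_right mult.assoc)
  then show ?thesis
    by (simp add: right_span_singleton image_image)
qed

section \<open>The reflection\<close>

lemma dihedral_S_image:
  "(*v) (map_matrix of_real dihedral_S) ` right_span {vector [a, b]} =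
   right_span {vector [a, - b] :: quat^2}"
proof -
  have "map_matrix of_real dihedral_S *v vector [a, b] = (vector [a, - b] :: quat^2)"
    by (simp add: vec_eq_iff forall_2 matrix_vector_mult_def sum_2 map_matrix_def dihedral_S_def)
  then show ?thesis by (simp add: matrix_image_right_span)
qed

lemma dihedral_S_image_vertical:
  "(*v) (map_matrix of_real dihedral_S) ` right_span {vector [0, 1]} =
   right_span {vector [0, 1] :: quat^2}"
  by (simp add: dihedral_S_image right_span_eq_vertical_iff)

lemma dihedral_S_permutes_axes:
  "permutes_lines (map_matrix of_real dihedral_S)
     {right_span {vector [1, 0]}, right_span {vector [0, 1]}}"
  using dihedral_S_image[of 1 0] dihedral_S_image_vertical by simp

lemma dihedral_S_permutes_mirror_pair:
  "permutes_lines (map_matrix of_real dihedral_S)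
     {right_span {vector [1, q]}, right_span {vector [1, - q]}}"
  by (simp add: dihedral_S_image insert_commute)

text \<open>
  The reflection sends slope \<open>q\<close> to \<open>- q\<close>, so a line that is not vertical is fixed only if its slope is
  \<open>0\<close>, and two distinct lines are interchanged only if neither is vertical and their slopes are opposite.
\<close>

lemma dihedral_S_permutes_cases:
  assumes "right_line V" "right_line W" "V \<noteq> W"
    and S: "permutes_lines (map_matrix of_real dihedral_S) {V, W}"
  obtains (axes) "{V, W} = {right_span {vector [1, 0]}, right_span {vector [0, 1]}}"
    | (mirror) q where "q \<noteq> 0" "{V, W} = {right_span {vector [1, q]}, right_span {vector [1, - q]}}"
  using assms(1)
proof (cases rule: right_line_cases)
  case V: (slope q)
  from assms(2) show thesis
  proof (cases rule: right_line_cases)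
    case W: (slope r)
    have "q \<noteq> r"
      using assms(3) V W by auto
    moreover have "- q = q \<and> - r = r \<or> - q = r \<and> - r = q"
      using S by (simp add: V W dihedral_S_image doubleton_eq_iff right_span_eq_slope_iff)
    ultimately have "q \<noteq> 0" "r = - q"
      by (auto simp: quat_uminus_eq_self_iff)
    with mirror show thesis
      by (simp add: V W)
  next
    case W: vertical
    have "- q = q"
      using S by (simp add: V W dihedral_S_image dihedral_S_image_vertical doubleton_eq_iff
          vertical_neq_slope right_span_eq_slope_iff)
    with axes show thesis
      by (simp add: V W quat_uminus_eq_self_iff)
  qed
next
  case V: vertical
  from assms(2) show thesis
  proof (cases rule: right_line_cases)
    case W: (slope r)
    have "- r = r"
      using S by (simp add: V W dihedral_S_image dihedral_S_image_vertical doubleton_eq_iff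
          vertical_neq_slope right_span_eq_slope_iff)
    with axes show thesis
      by (simp add: V W quat_uminus_eq_self_iff insert_commute)
  next
    case vertical
    with V assms(3) show thesis by simp
  qed
qed

section \<open>The rotation\<close>

lemma sin_rotation_pos: "n \<ge> 3 \<Longrightarrow> sin (2 * pi / real n) > 0"
  by (intro sin_gt_zero) (auto simp: field_simps)

text \<open>For \<open>n \<ge> 3\<close> the angle lies strictly between \<open>0\<close> and \<open>\<pi>\<close>, where the cosine is injective.\<close>

lemma cos_rotation_eq_0_iff:
  assumes "n \<ge> 3"
  shows "cos (2 * pi / real n) = 0 \<longleftrightarrow> n = 4"
proof
  assume cos_0: "cos (2 * pi / real n) = 0"
  have "2 * pi / real n = pi / 2"
  proof (rule cos_inj_pi)
    show "2 * pi / real n \<le> pi"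
      using assms by (simp add: divide_le_eq mult.commute)
  qed (auto simp: cos_0)
  then have "2 * pi * 2 = pi * real n"
    using assms by (subst (asm) frac_eq_eq) auto
  then have "real n = 4"
    by simp
  then show "n = 4" by simp
qed (simp add: mult.commute)

lemma dihedral_R_image:
  "(*v) (map_matrix of_real (dihedral_R n)) ` right_span {vector [a, b]} =
   right_span {vector [cos (2 * pi / real n) *\<^sub>R a - sin (2 * pi / real n) *\<^sub>R b,
     sin (2 * pi / real n) *\<^sub>R a + cos (2 * pi / real n) *\<^sub>R b] :: quat^2}"
proof -
  have "map_matrix of_real (dihedral_R n) *v vector [a, b] =
    (vector [cos (2 * pi / real n) *\<^sub>R a - sin (2 * pi / real n) *\<^sub>R b,
     sin (2 * pi / real n) *\<^sub>R a + cos (2 * pi / real n) *\<^sub>R b] :: quat^2)"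
    by (simp add: vec_eq_iff forall_2 matrix_vector_mult_def sum_2 map_matrix_def dihedral_R_def
        scaleR_conv_of_real)
  then show ?thesis by (simp add: matrix_image_right_span)
qed

lemma dihedral_R_permutes_axes_iff:
  assumes "n \<ge> 3"
  shows "permutes_lines (map_matrix of_real (dihedral_R n))
      {right_span {vector [1, 0]}, right_span {vector [0, 1]}} \<longleftrightarrow> n = 4"
proof -
  have "sin (2 * pi / real n) \<noteq> 0"
    using sin_rotation_pos[OF assms] by simp
  then show ?thesis
    by (auto simp: dihedral_R_image doubleton_eq_iff right_span_eq_slope_iff
        right_span_eq_vertical_iff cos_rotation_eq_0_iff[OF assms])
qed

text \<open>
  The quaternion \<open>q\<close> commutes with the real entries of \<open>R\<close>, so the slope equations for \<open>R\<close> can be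
  expanded as if in a field.  Both lines must be followed in the interchanging case: the equation for
  \<open>q\<close> alone has a real solution for every \<open>n\<close>, namely \<open>- tan (\<pi>/n)\<close>, the slope of a line that \<open>R\<close>
  sends to its mirror image.
\<close>

lemma dihedral_R_permutes_mirror_pair_iff:
  assumes "n \<ge> 3" "q \<noteq> 0"
  shows "permutes_lines (map_matrix of_real (dihedral_R n))
      {right_span {vector [1, q]}, right_span {vector [1, - q]}} \<longleftrightarrow>
    q * q = -1 \<or> n = 4 \<and> q * q = 1"
proof -
  define c s where "c = cos (2 * pi / real n)" and "s = sin (2 * pi / real n)"
  have s: "s \<noteq> 0"
    using sin_rotation_pos[OF assms(1)] by (simp add: s_def)
  have c: "c = 0 \<longleftrightarrow> n = 4"
    using cos_rotation_eq_0_iff[OF assms(1)] by (simp add: c_def)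
  have fix_iff: "s *\<^sub>R 1 + c *\<^sub>R p = p * (c *\<^sub>R 1 - s *\<^sub>R p) \<longleftrightarrow> p * p = -1" for p :: quat
  proof -
    have "s *\<^sub>R 1 + c *\<^sub>R p = p * (c *\<^sub>R 1 - s *\<^sub>R p) \<longleftrightarrow> s *\<^sub>R (p * p + 1) = 0"
      by (simp add: right_diff_distrib algebra_simps add_eq_0_iff2)
    then show ?thesis
      using s by (simp add: eq_neg_iff_add_eq_0)
  qed
  have swap_iff: "s *\<^sub>R 1 + c *\<^sub>R p = - p * (c *\<^sub>R 1 - s *\<^sub>R p) \<longleftrightarrow>
      s *\<^sub>R (1 - p * p) + (2 * c) *\<^sub>R p = 0" for p :: quat
    by (auto simp: quat_eq_iff algebra_simps)
  \<comment> \<open>A fixed line also needs its image vector to be nonzero; here \<open>c - s p\<close> has inverse \<open>c + s p\<close>.\<close>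
  have nonzero: "c *\<^sub>R 1 - s *\<^sub>R p \<noteq> 0" if "p * p = -1" for p :: quat
  proof
    assume "c *\<^sub>R 1 - s *\<^sub>R p = 0"
    have "(c *\<^sub>R 1 - s *\<^sub>R p) * (c *\<^sub>R 1 + s *\<^sub>R p) = (c * c) *\<^sub>R 1 - (s * s) *\<^sub>R (p * p)"
      by (simp add: algebra_simps)
    also have "\<dots> = (c\<^sup>2 + s\<^sup>2) *\<^sub>R 1"
      by (simp add: that power2_eq_square scaleR_add_left)
    also have "\<dots> = 1"
      by (simp add: c_def s_def)
    finally show False
      using \<open>c *\<^sub>R 1 - s *\<^sub>R p = 0\<close> by simp
  qed
  have "permutes_lines (map_matrix of_real (dihedral_R n))
      {right_span {vector [1, q]}, right_span {vector [1, - q]}} \<longleftrightarrow>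
    q * q = -1 \<or>
    (c *\<^sub>R 1 - s *\<^sub>R q \<noteq> 0 \<and> s *\<^sub>R (1 - q * q) + (2 * c) *\<^sub>R q = 0) \<and>
    (c *\<^sub>R 1 - s *\<^sub>R - q \<noteq> 0 \<and> s *\<^sub>R (1 - q * q) + (2 * c) *\<^sub>R - q = 0)"
    using fix_iff[of q] fix_iff[of "- q"] swap_iff[of q] swap_iff[of "- q"]
      nonzero[of q] nonzero[of "- q"]
    unfolding image_insert image_empty dihedral_R_image doubleton_eq_iff right_span_eq_slope_iff
    by (auto simp: c_def[symmetric] s_def[symmetric])
  also have "\<dots> \<longleftrightarrow> q * q = -1 \<or> n = 4 \<and> q * q = 1"
  proof -
    have "c = 0 \<and> q * q = 1" if
      "s *\<^sub>R (1 - q * q) + (2 * c) *\<^sub>R q = 0" "s *\<^sub>R (1 - q * q) + (2 * c) *\<^sub>R - q = 0"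
    proof -
      \<comment> \<open>Subtracting the equations for \<open>q\<close> and \<open>- q\<close> isolates the linear term.\<close>
      have "(4 * c) *\<^sub>R q = (s *\<^sub>R (1 - q * q) + (2 * c) *\<^sub>R q) -
          (s *\<^sub>R (1 - q * q) + (2 * c) *\<^sub>R - q)"
        by (simp add: quat_eq_iff)
      with that have "(4 * c) *\<^sub>R q = 0" by simp
      with assms(2) have "c = 0" by simp
      with that(1) s show ?thesis by simp
    qed
    with s assms(2) show ?thesis
      by (auto simp: c[symmetric])
  qed
  finally show ?thesis .
qed

section \<open>Classification\<close>

lemma system_of_imprimitivity_system_given_by_iff:
  "system_of_imprimitivity (dihedral_quat n) (system_given_by q) \<longleftrightarrow>
     permutes_lines (map_matrix of_real (dihedral_R n)) (system_given_by q) \<and>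
     permutes_lines (map_matrix of_real dihedral_S) (system_given_by q)"
proof -
  have "\<exists>V W. system_given_by q = {V, W} \<and> right_line V \<and> right_line W \<and> direct_sum_decomp V W"
    using system_given_by_eq[of q] right_line_vector direct_sum_orthogonal[of q]
    by (metis zero_neq_one)
  then show ?thesis
    unfolding system_of_imprimitivity_def dihedral_quat_permutes_lines_iff by blast
qed

lemma system_of_imprimitivity_listed:
  assumes "n \<ge> 3" "listed n q"
  shows "system_of_imprimitivity (dihedral_quat n) (system_given_by q)"
proof (cases "q = 0")
  case True
  have "norm quat_i = 1"
    using quat_i_square quat_square_eq_minus_1_iff by blast
  with True assms(2) have "n = 4"
    by (auto simp: listed_def)
  with True assms(1) show ?thesis
    unfolding True system_of_imprimitivity_system_given_by_iff
    unfolding system_given_by_0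
    by (simp only: dihedral_R_permutes_axes_iff dihedral_S_permutes_axes)
next
  case False
  have q: "q * q = -1 \<or> n = 4 \<and> q * q = 1"
    using assms(2) False quat_i_square quat_square_eq_minus_1_iff[of q] mult_1[of "1 :: quat"]
    unfolding listed_def by blast
  then have "norm q = 1"
    using norm_eq_1_if_square_unit by blast
  then have "system_given_by q = {right_span {vector [1, q]}, right_span {vector [1, - q]}}"
    by (rule system_given_by_unit)
  with q show ?thesis
    using dihedral_R_permutes_mirror_pair_iff[OF assms(1) False] dihedral_S_permutes_mirror_pair[of q]
    unfolding system_of_imprimitivity_system_given_by_iff by presburger
qed

lemma system_of_imprimitivity_imp_listed:
  assumes "n \<ge> 3" "system_of_imprimitivity (dihedral_quat n) P"
  shows "\<exists>q. P = system_given_by q \<and> listed n q"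
proof -
  obtain V W where P: "P = {V, W}" and lines: "right_line V" "right_line W"
    and sum: "direct_sum_decomp V W"
    using assms(2) unfolding system_of_imprimitivity_def by blast
  have R: "permutes_lines (map_matrix of_real (dihedral_R n)) P"
    and S: "permutes_lines (map_matrix of_real dihedral_S) {V, W}"
    using assms(2) P unfolding system_of_imprimitivity_def dihedral_quat_permutes_lines_iff by auto
  from lines direct_sum_lines_neq[OF lines(1) sum] S show ?thesis
  proof (cases rule: dihedral_S_permutes_cases)
    case axes
    with R P assms(1) have "n = 4"
      by (simp only: dihedral_R_permutes_axes_iff)
    moreover have "P = system_given_by 0"
      using axes P by (simp only: system_given_by_0)
    ultimately show ?thesis
      unfolding listed_def by blast
  next
    case (mirror q)
    then have q: "q * q = -1 \<or> n = 4 \<and> q * q = 1"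
      using R P dihedral_R_permutes_mirror_pair_iff[OF assms(1) mirror(1)] by metis
    then have unit: "norm q = 1"
      using norm_eq_1_if_square_unit by blast
    then have given: "P = system_given_by q" "P = system_given_by (- q)"
      using mirror(2) P system_given_by_unit system_given_by_uminus by metis+
    \<comment> \<open>Neither \<open>- quat_i\<close> nor \<open>-1\<close> is listed, so the sign of \<open>q\<close> may have to be changed.\<close>
    have "listed n q \<or> listed n (- q)"
      using q
    proof
      assume "q * q = -1"
      then have "q = quat_i \<or> - q = quat_i \<or> norm q = 1 \<and> q \<notin> quat_complex \<and> qRe q = 0"
        using quat_complex_square_eq_minus_1[of q] quat_square_eq_minus_1_iff[of q]
        by (metis minus_minus)
      then show ?thesis
        unfolding listed_def by blast
    next
      assume "n = 4 \<and> q * q = 1"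
      then have "n = 4" "q = 1 \<or> - q = 1"
        by (auto simp: square_eq_1_iff)
      then show ?thesis
        unfolding listed_def by blast
    qed
    with given show ?thesis by blast
  qed
qed

theorem theorem3p1:
  shows "(\<forall>n\<ge>3. {P. system_of_imprimitivity (dihedral_quat n) P} =
                 {system_given_by q | q. listed n q}) \<and>
         (\<forall>q. norm q = 1 \<longrightarrow> system_given_by q = system_given_by (- q)) \<and>
         (\<forall>m\<ge>3. \<forall>n\<ge>3. \<forall>q r. listed m q \<longrightarrow> listed n r \<longrightarrow> q \<noteq> r \<longrightarrow>
            \<not> (norm q = 1 \<and> r = - q) \<longrightarrow> system_given_by q \<noteq> system_given_by r)"
proof (intro conjI allI impI)
  fix n :: nat
  assume "n \<ge> 3"
  then show "{P. system_of_imprimitivity (dihedral_quat n) P} = {system_given_by q | q. listed n q}"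
    using system_of_imprimitivity_listed system_of_imprimitivity_imp_listed by blast
next
  fix q :: quat
  assume "norm q = 1"
  then show "system_given_by q = system_given_by (- q)"
    by (rule system_given_by_uminus)
next
  fix m n q r
  assume "listed m q" "q \<noteq> r" "\<not> (norm q = 1 \<and> r = - q)"
  moreover from this have "q = 0 \<or> norm q = 1"
    using quat_i_square quat_square_eq_minus_1_iff[of quat_i] by (auto simp: listed_def)
  ultimately show "system_given_by q \<noteq> system_given_by r"
    using system_given_by_inject by blast
qed

end
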